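(* Let $\{G_\alpha : \alpha\in A\}$ be an arbitrary family of feebly compact paratopological groups. Then the Tychonoff product $\prod_{\alpha\in A} G_\alpha$ (the product group with the product topology) is feebly compact.
   Context: A paratopological group is a group $G$ with a topology such that the multiplication $G\times G\to G$, $(x,y)\mapsto xy$, is continuous (inversion need not be continuous). A space $X$ is feebly compact if each locally finite family of open subsets of $X$ is finite. No separation axioms are assumed. *)

theory Defs
  imports "HOL-Analysis.Analysis" "HOL-Algebra.Product_Groups"
begin

text \<open>Topologies are objects \<^typ>\<open>'a topology\<close> on the carrier of the group, so that no separation
  axiom (and no type class on the ground type) is involved.\<close>

locale paratopological_group = group G for G (structure) +
  fixes T :: "'a topology"
  assumes topspace_eq_carrier: "topspace T = carrier G"
    and continuous_mult: "continuous_map (prod_topology T T) T (\<lambda>(x, y). x \<otimes> y)"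

text \<open>Families of subsets are sets of sets. Reading them as indexed families of nonempty sets gives
  the same notion: in a locally finite indexed family a nonempty set can occur only finitely
  often.\<close>

definition feebly_compact :: "'a topology \<Rightarrow> bool" where
  "feebly_compact X \<longleftrightarrow>
     (\<forall>\<U>. (\<forall>U\<in>\<U>. openin X U) \<and> locally_finite_in X \<U> \<longrightarrow> finite \<U>)"

text \<open>The Tychonoff product of paratopological groups is the library's \<^const>\<open>product_group\<close>
  (extensional functions, componentwise multiplication) with the library's
  \<^const>\<open>product_topology\<close>; the following lemma records that these fit together.\<close>

lemma paratopological_group_product:
  assumes "\<And>i. i \<in> A \<Longrightarrow> paratopological_group (G i) (T i)"
  shows "paratopological_group (product_group A G) (product_topology T A)"
proof -
  have grp: "group (G i)" and top: "topspace (T i) = carrier (G i)"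
    and mult: "continuous_map (prod_topology (T i) (T i)) (T i) (\<lambda>(x, y). x \<otimes>\<^bsub>G i\<^esub> y)"
    if "i \<in> A" for i
    using assms[OF that]
    by (simp_all add: paratopological_group_def paratopological_group_axioms_def)
  let ?P = "product_topology T A"
  have "continuous_map (prod_topology ?P ?P) (T i) (\<lambda>p. fst p i \<otimes>\<^bsub>G i\<^esub> snd p i)"
    if i: "i \<in> A" for i
  proof -
    have "continuous_map (prod_topology ?P ?P) (T i) (\<lambda>p. fst p i)"
      using continuous_map_compose[OF continuous_map_fst continuous_map_product_projection[OF i]]
      by (simp add: o_def)
    moreover have "continuous_map (prod_topology ?P ?P) (T i) (\<lambda>p. snd p i)"
      using continuous_map_compose[OF continuous_map_snd continuous_map_product_projection[OF i]]
      by (simp add: o_def)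
    ultimately have "continuous_map (prod_topology ?P ?P) (prod_topology (T i) (T i))
        (\<lambda>p. (fst p i, snd p i))"
      by (simp add: continuous_map_pairedI)
    from continuous_map_compose[OF this mult[OF i]] show ?thesis
      by (simp add: o_def)
  qed
  then have "continuous_map (prod_topology ?P ?P) ?P
      (\<lambda>p. \<lambda>i\<in>A. fst p i \<otimes>\<^bsub>G i\<^esub> snd p i)"
    by (auto simp: continuous_map_componentwise extensional_def)
  moreover have "topspace ?P = carrier (product_group A G)"
    by (auto simp: top intro!: PiE_cong)
  ultimately show ?thesis
    using grp by (simp add: paratopological_group_def paratopological_group_axioms_def case_prod_unfold)
qed

end

theory Submission
  imports Defs "HOL-Library.Diagonal_Subsequence"
begin

text \<open>Feeble compactness says that every sequence of nonempty open sets has a cluster point. Call a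
  space sequentially feebly compact if every such sequence even has a subsequence that converges to
  some point \<open>x\<close>, i.e. every neighbourhood of \<open>x\<close> meets almost all of its members. This stronger
  property is productive, and every feebly compact paratopological group has it. The key is that
  inversion is almost continuous in such a group: each neighbourhood \<open>U\<close> of the identity has a
  neighbourhood \<open>W\<close> of the identity with \<open>W\<inverse> \<subseteq> cl U\<close>.\<close>

section \<open>Cluster points and limits of sequences of sets\<close>

text \<open>Membership in the upper Kuratowski limit. Indices are counted rather than distinct sets,
  so a set that recurs infinitely often clusters at each of its points.\<close>

definition cluster_point_in :: "'a topology \<Rightarrow> (nat \<Rightarrow> 'a set) \<Rightarrow> 'a \<Rightarrow> bool" where
  "cluster_point_in X U x \<longleftrightarrow>
     x \<in> topspace X \<and> (\<forall>V. openin X V \<and> x \<in> V \<longrightarrow> infinite {n. V \<inter> U n \<noteq> {}})"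

text \<open>Membership in the lower Kuratowski limit; such points are in general far from
  unique.\<close>

definition set_limit_in :: "'a topology \<Rightarrow> (nat \<Rightarrow> 'a set) \<Rightarrow> 'a \<Rightarrow> bool" where
  "set_limit_in X U x \<longleftrightarrow>
     x \<in> topspace X \<and> (\<forall>V. openin X V \<and> x \<in> V \<longrightarrow> (\<forall>\<^sub>F n in sequentially. V \<inter> U n \<noteq> {}))"

definition seq_feebly_compact :: "'a topology \<Rightarrow> bool" where
  "seq_feebly_compact X \<longleftrightarrow>
     (\<forall>U :: nat \<Rightarrow> 'a set. (\<forall>n. openin X (U n) \<and> U n \<noteq> {}) \<longrightarrow>
        (\<exists>x r. strict_mono r \<and> set_limit_in X (U \<circ> r) x))"

lemma cluster_point_in_openD:
  assumes "cluster_point_in X U x" "openin X V" "x \<in> V"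
  obtains n where "n \<ge> N" "V \<inter> U n \<noteq> {}"
proof -
  have "infinite {n. V \<inter> U n \<noteq> {}}"
    using assms by (simp add: cluster_point_in_def)
  then show thesis
    using that by (auto simp: infinite_nat_iff_unbounded_le)
qed

lemma set_limit_in_subseq:
  assumes "set_limit_in X U x" "strict_mono r"
  shows "set_limit_in X (U \<circ> r) x"
  using assms eventually_subseq[of r] by (fastforce simp: set_limit_in_def)

lemma set_limit_in_offset:
  "set_limit_in X (\<lambda>n. U (n + k)) x \<longleftrightarrow> set_limit_in X U x"
  unfolding set_limit_in_def
  using eventually_sequentially_seg[of "\<lambda>n. V \<inter> U n \<noteq> {}" k for V] by simp

lemma set_limit_in_mono:
  assumes "set_limit_in X U x" "\<And>n. U n \<subseteq> U' n"
  shows "set_limit_in X U' x"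
proof -
  have "\<forall>\<^sub>F n in sequentially. V \<inter> U' n \<noteq> {}"
    if "\<forall>\<^sub>F n in sequentially. V \<inter> U n \<noteq> {}" for V
    using that by (rule eventually_mono) (use assms(2) in blast)
  with assms(1) show ?thesis
    by (simp add: set_limit_in_def)
qed

text \<open>If nothing clusters, the range is locally finite, hence finite. By the pigeonhole
  principle one set then recurs infinitely often, and its points are cluster points after
  all.\<close>

lemma feebly_compact_cluster_point:
  assumes fc: "feebly_compact X" and U: "\<And>n. openin X (U n)" "\<And>n. U n \<noteq> {}"
  obtains x where "cluster_point_in X U x"
proof (rule ccontr)
  assume "\<not> thesis"
  then have none: "\<not> cluster_point_in X U x" for x
    using that by blast
  have img: "{W \<in> range U. W \<inter> V \<noteq> {}} = U ` {n. V \<inter> U n \<noteq> {}}" for V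
    by auto
  have "\<exists>V. openin X V \<and> x \<in> V \<and> finite {W \<in> range U. W \<inter> V \<noteq> {}}" if "x \<in> topspace X" for x
    using none[of x] that unfolding img by (auto simp: cluster_point_in_def)
  then have "locally_finite_in X (range U)"
    unfolding locally_finite_in_def using openin_subset[OF U(1)] by blast
  then have "finite (range U)"
    using fc U by (auto simp: feebly_compact_def)
  then obtain k where inf: "infinite {n. U n = U k}"
    using pigeonhole_infinite[of UNIV U] by auto
  obtain x where x: "x \<in> U k"
    using U by blast
  have "infinite {n. V \<inter> U n \<noteq> {}}" if "x \<in> V" for V
    by (rule infinite_super[OF _ inf]) (use that x in auto)
  then have "cluster_point_in X U x"
    using x openin_subset[OF U(1)] by (auto simp: cluster_point_in_def)
  then show False
    using none by blast
qed

text \<open>An infinite family contains an injective sequence of nonempty members. Each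
  neighbourhood of a limit of a subsequence meets infinitely many distinct members, against local
  finiteness.\<close>

lemma seq_feebly_compact_imp_feebly_compact:
  assumes "seq_feebly_compact X"
  shows "feebly_compact X"
  unfolding feebly_compact_def
proof (intro allI impI, elim conjE, rule ccontr)
  fix \<U>
  assume opn: "\<forall>U\<in>\<U>. openin X U" and lf: "locally_finite_in X \<U>" and "infinite \<U>"
  then have "infinite (\<U> - {{}})"
    by simp
  then obtain U :: "nat \<Rightarrow> 'a set" where inj: "inj U" and U: "range U \<subseteq> \<U> - {{}}"
    using infinite_countable_subset by blast
  then obtain x r where r: "strict_mono r" and x: "set_limit_in X (U \<circ> r) x"
    using assms opn unfolding seq_feebly_compact_def by (metis Diff_iff insertI1 rangeI subsetD)
  then obtain V where V: "openin X V" "x \<in> V" "finite {W \<in> \<U>. W \<inter> V \<noteq> {}}"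
    using lf by (auto simp: locally_finite_in_def set_limit_in_def)
  then have "\<forall>\<^sub>F n in sequentially. V \<inter> U (r n) \<noteq> {}"
    using x by (auto simp: set_limit_in_def)
  then obtain N where N: "\<And>n. n \<ge> N \<Longrightarrow> V \<inter> U (r n) \<noteq> {}"
    by (auto simp: eventually_sequentially)
  have "(U \<circ> r) ` {N..} \<subseteq> {W \<in> \<U>. W \<inter> V \<noteq> {}}"
    using N U by fastforce
  moreover have "infinite ((U \<circ> r) ` {N..})"
    using inj strict_mono_imp_inj_on[OF r]
    by (metis comp_inj_on_iff finite_imageD infinite_Ici inj_on_subset subset_UNIV)
  ultimately show False
    using V finite_subset by blast
qed

section \<open>Products of sequentially feebly compact spaces\<close>

text \<open>A basic neighbourhood restricts finitely many coordinates, so finitely many "eventually"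
  statements combine; in the remaining coordinates nonemptiness of the boxes suffices.\<close>

lemma set_limit_in_product:
  assumes lim: "\<And>i. i \<in> I \<Longrightarrow> set_limit_in (X i) (\<lambda>n. B n i) (x i)"
    and x: "x \<in> extensional I"
    and ne: "\<And>n. Pi\<^sub>E I (B n) \<noteq> {}" and sub: "\<And>n i. i \<in> I \<Longrightarrow> B n i \<subseteq> topspace (X i)"
  shows "set_limit_in (product_topology X I) (\<lambda>n. Pi\<^sub>E I (B n)) x"
  unfolding set_limit_in_def
proof (intro conjI allI impI)
  show "x \<in> topspace (product_topology X I)"
    using lim x by (auto simp: set_limit_in_def PiE_iff)
  fix V assume "openin (product_topology X I) V \<and> x \<in> V"
  then obtain C where fin: "finite {i \<in> I. C i \<noteq> topspace (X i)}"
    and C: "\<And>i. i \<in> I \<Longrightarrow> openin (X i) (C i)" "x \<in> Pi\<^sub>E I C" "Pi\<^sub>E I C \<subseteq> V"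
    by (auto simp: openin_product_topology_alt)
  have "\<forall>\<^sub>F n in sequentially. \<forall>i\<in>{i \<in> I. C i \<noteq> topspace (X i)}. C i \<inter> B n i \<noteq> {}"
    using fin by (rule eventually_ball_finite) (use lim C in \<open>auto simp: set_limit_in_def PiE_iff\<close>)
  then show "\<forall>\<^sub>F n in sequentially. V \<inter> Pi\<^sub>E I (B n) \<noteq> {}"
  proof eventually_elim
    case (elim n)
    have "C i \<inter> B n i \<noteq> {}" if "i \<in> I" for i
    proof (cases "C i = topspace (X i)")
      case True
      with ne[of n] sub[OF that, of n] that show ?thesis
        by (auto simp: PiE_eq_empty_iff)
    qed (use elim that in auto)
    then have "Pi\<^sub>E I (\<lambda>i. C i \<inter> B n i) \<noteq> {}"
      by (simp add: PiE_eq_empty_iff)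
    with C show ?case
      by (auto simp: PiE_Int[symmetric])
  qed
qed

text \<open>Only countably many coordinates restrict a sequence of basic open boxes, so a diagonal
  subsequence converges in all of them.\<close>

lemma seq_feebly_compact_product:
  assumes sfc: "\<And>i. i \<in> I \<Longrightarrow> seq_feebly_compact (X i)"
  shows "seq_feebly_compact (product_topology X I)"
  unfolding seq_feebly_compact_def
proof (intro allI impI)
  fix U :: "nat \<Rightarrow> ('a \<Rightarrow> 'b) set"
  assume U: "\<forall>n. openin (product_topology X I) (U n) \<and> U n \<noteq> {}"
  have "\<exists>B. finite {i \<in> I. B i \<noteq> topspace (X i)} \<and> (\<forall>i\<in>I. openin (X i) (B i)) \<and>
          Pi\<^sub>E I B \<noteq> {} \<and> Pi\<^sub>E I B \<subseteq> U n" (is "\<exists>B. ?box n B") for n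
  proof -
    obtain f where f: "f \<in> U n"
      using U by blast
    have "openin (product_topology X I) (U n)"
      using U by blast
    then obtain B where B: "finite {i \<in> I. B i \<noteq> topspace (X i)}"
        "\<forall>i\<in>I. openin (X i) (B i)" "f \<in> Pi\<^sub>E I B" "Pi\<^sub>E I B \<subseteq> U n"
      using f by (auto simp: openin_product_topology_alt)
    from B(3) have "Pi\<^sub>E I B \<noteq> {}"
      by blast
    with B show ?thesis
      by (intro exI[of _ B] conjI)
  qed
  then have "\<exists>B. \<forall>n. ?box n (B n)"
    by (intro choice allI)
  then obtain B where "\<forall>n. ?box n (B n)" ..
  then have fin: "\<And>n. finite {i \<in> I. B n i \<noteq> topspace (X i)}"
    and B: "\<And>n i. i \<in> I \<Longrightarrow> openin (X i) (B n i)" "\<And>n. Pi\<^sub>E I (B n) \<noteq> {}"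
      "\<And>n. Pi\<^sub>E I (B n) \<subseteq> U n"
    by simp_all
  have ne: "B n i \<noteq> {}" if "i \<in> I" for n i
    using B(2)[of n] that by (auto simp: PiE_eq_empty_iff)
  define J where "J = (\<Union>n. {i \<in> I. B n i \<noteq> topspace (X i)})"
  have J: "countable J"
    using fin by (auto simp: J_def intro: countable_finite)
  \<comment> \<open>The premise fails only for empty \<open>J\<close>, where
    \<open>from_nat_into J\<close> enumerates nothing.\<close>
  define P where "P k s \<longleftrightarrow> (from_nat_into J k \<in> J \<longrightarrow>
      (\<exists>x. set_limit_in (X (from_nat_into J k)) (\<lambda>n. B (s n) (from_nat_into J k)) x))"
    for k and s :: "nat \<Rightarrow> nat"
  interpret subseqs P
  proof
    fix k and s :: "nat \<Rightarrow> nat" assume "strict_mono s"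
    show "\<exists>r. strict_mono r \<and> P k (s \<circ> r)"
    proof (cases "from_nat_into J k \<in> J")
      case True
      define i where "i = from_nat_into J k"
      have "i \<in> I"
        using True by (auto simp: i_def J_def)
      then obtain x r where "strict_mono r" "set_limit_in (X i) ((\<lambda>n. B (s n) i) \<circ> r) x"
        using sfc[OF \<open>i \<in> I\<close>] B(1) ne unfolding seq_feebly_compact_def by metis
      then show ?thesis
        by (auto simp: P_def i_def o_def)
    qed (use strict_mono_id in \<open>auto simp: P_def\<close>)
  qed
  \<comment> \<open>The diagonal sequence is a subsequence of the \<open>k\<close>-th selection only
    from index \<open>Suc k\<close> on, so \<open>P k\<close> has to survive subsequences;
    \<open>set_limit_in_offset\<close> later removes the shift.\<close>
  have stable: "P k (s \<circ> r)" if r: "strict_mono r" and Ps: "P k s" for r s k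
    unfolding P_def
  proof
    assume "from_nat_into J k \<in> J"
    then obtain x where
      "set_limit_in (X (from_nat_into J k)) (\<lambda>n. B (s n) (from_nat_into J k)) x"
      using Ps by (auto simp: P_def)
    from set_limit_in_subseq[OF this r]
    show "\<exists>x. set_limit_in (X (from_nat_into J k)) (\<lambda>n. B ((s \<circ> r) n) (from_nat_into J k)) x"
      by (auto simp: o_def)
  qed
  have "\<exists>x. set_limit_in (X i) (\<lambda>n. B (diagseq n) i) x" if i: "i \<in> I" for i
  proof (cases "i \<in> J")
    case True
    with from_nat_into_surj[OF J] obtain k where k: "from_nat_into J k = i"
      by blast
    have "P k (diagseq \<circ> (+) (Suc k))"
      by (rule diagseq_holds) (rule stable)
    then have "\<exists>x. set_limit_in (X i) (\<lambda>n. B (diagseq (n + Suc k)) i) x"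
      using True k by (simp add: P_def o_def add.commute)
    then show ?thesis
      unfolding set_limit_in_offset[where U = "\<lambda>n. B (diagseq n) i"] .
  next
    case False
    \<comment> \<open>Outside \<open>J\<close> every box is the whole factor, so any point of it is
      a limit.\<close>
    then have B_top: "B n i = topspace (X i)" for n
      using that by (auto simp: J_def)
    then obtain a where a: "a \<in> topspace (X i)"
      using ne[OF i, of 0] by fast
    then have "set_limit_in (X i) (\<lambda>n. B (diagseq n) i) a"
      unfolding set_limit_in_def B_top by auto
    then show ?thesis ..
  qed
  then have "\<exists>x. \<forall>i\<in>I. set_limit_in (X i) (\<lambda>n. B (diagseq n) i) (x i)"
    by (intro bchoice ballI)
  then obtain x where x: "\<And>i. i \<in> I \<Longrightarrow> set_limit_in (X i) (\<lambda>n. B (diagseq n) i) (x i)"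
    by blast
  have "set_limit_in (product_topology X I) (\<lambda>n. Pi\<^sub>E I (B (diagseq n))) (restrict x I)"
    by (rule set_limit_in_product) (use x B(2) openin_subset[OF B(1)] in simp_all)
  then have "set_limit_in (product_topology X I) (U \<circ> diagseq) (restrict x I)"
    by (rule set_limit_in_mono) (simp add: B(3))
  then show "\<exists>x r. strict_mono r \<and> set_limit_in (product_topology X I) (U \<circ> r) x"
    using subseq_diagseq by blast
qed

section \<open>Feebly compact paratopological groups\<close>

context paratopological_group
begin

lemma openin_subset_carrier: "openin T U \<Longrightarrow> U \<subseteq> carrier G"
  using openin_subset topspace_eq_carrier by metis

lemma continuous_map_mult_left: "a \<in> carrier G \<Longrightarrow> continuous_map T T (\<lambda>z. a \<otimes> z)"
  using continuous_map_compose[OF _ continuous_mult, of T "\<lambda>z. (a, z)"]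
  by (simp add: o_def continuous_map_pairedI topspace_eq_carrier)

lemma continuous_map_mult_right: "a \<in> carrier G \<Longrightarrow> continuous_map T T (\<lambda>z. z \<otimes> a)"
  using continuous_map_compose[OF _ continuous_mult, of T "\<lambda>z. (z, a)"]
  by (simp add: o_def continuous_map_pairedI topspace_eq_carrier)

text \<open>The translate is the preimage of \<open>U\<close> under the continuous left
  multiplication by \<open>inv x\<close>.\<close>

lemma openin_left_translate:
  assumes U: "openin T U" and x: "x \<in> carrier G"
  shows "openin T ((\<otimes>) x ` U)"
proof -
  have "(\<otimes>) x ` U = {z \<in> topspace T. inv x \<otimes> z \<in> U}"
  proof (intro equalityI subsetI)
    fix z assume "z \<in> {z \<in> topspace T. inv x \<otimes> z \<in> U}"
    then show "z \<in> (\<otimes>) x ` U"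
      using x by (intro image_eqI[of _ _ "inv x \<otimes> z"])
        (auto simp: topspace_eq_carrier m_assoc[symmetric])
  qed (use x openin_subset_carrier[OF U] in \<open>auto simp: topspace_eq_carrier m_assoc[symmetric]\<close>)
  then show ?thesis
    using openin_continuous_map_preimage[OF continuous_map_mult_left U, of "inv x"] x by simp
qed

text \<open>The closure of \<open>S \<times> S'\<close> is the product of the closures, and a
  continuous map sends the closure of a set into the closure of its image.\<close>

lemma mult_in_closure_of:
  assumes "a \<in> T closure_of S" "b \<in> T closure_of S'"
    and "\<And>s t. s \<in> S \<Longrightarrow> t \<in> S' \<Longrightarrow> s \<otimes> t \<in> R"
  shows "a \<otimes> b \<in> T closure_of R"
proof -
  have "(a, b) \<in> prod_topology T T closure_of (S \<times> S')"
    using assms by (simp add: closure_of_Times)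
  then have "a \<otimes> b \<in> T closure_of ((\<lambda>(x, y). x \<otimes> y) ` (S \<times> S'))"
    using continuous_map_image_closure_subset[OF continuous_mult] by fastforce
  also have "\<dots> \<subseteq> T closure_of R"
    using assms(3) by (intro closure_of_mono) auto
  finally show ?thesis .
qed

lemma inv_mult_cancel: "a \<in> carrier G \<Longrightarrow> b \<in> carrier G \<Longrightarrow> inv a \<otimes> (a \<otimes> b) = b"
  by (simp add: m_assoc[symmetric])

lemma in_closure_of_self:
  assumes "s \<in> S" "s \<in> carrier G"
  shows "s \<in> T closure_of S"
  using assms by (auto simp: in_closure_of topspace_eq_carrier)

lemma nbhd_one_square:
  assumes U: "openin T U" "\<one> \<in> U"
  obtains V where "openin T V" "\<one> \<in> V" "V \<subseteq> U" "\<And>a b. a \<in> V \<Longrightarrow> b \<in> V \<Longrightarrow> a \<otimes> b \<in> U"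
proof -
  let ?W = "{p \<in> topspace (prod_topology T T). (\<lambda>(x, y). x \<otimes> y) p \<in> U}"
  have "openin (prod_topology T T) ?W"
    using openin_continuous_map_preimage[OF continuous_mult U(1)] .
  moreover have "(\<one>, \<one>) \<in> ?W"
    using U(2) by (simp add: topspace_eq_carrier)
  ultimately have "\<exists>P Q. openin T P \<and> openin T Q \<and> \<one> \<in> P \<and> \<one> \<in> Q \<and> P \<times> Q \<subseteq> ?W"
    unfolding openin_prod_topology_alt by blast
  then obtain P Q where PQ: "openin T P" "openin T Q" "\<one> \<in> P" "\<one> \<in> Q" "P \<times> Q \<subseteq> ?W"
    by blast
  show thesis
  proof (rule that)
    show "openin T (P \<inter> Q \<inter> U)"
      using PQ U by blast
  qed (use PQ U in auto)
qed

text \<open>Otherwise there are arbitrarily small \<open>z\<close> with \<open>z\<inverse> \<notin> cl U\<close>. Multiplying on the right by such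
  elements gives points \<open>x\<^sub>n\<close> with \<open>x\<^sub>n \<notin> cl (x\<^sub>n\<^sub>+\<^sub>1 U)\<close> lying in decreasing open sets
  \<open>B\<^sub>n \<subseteq> x\<^sub>n V\<close>, where \<open>V V \<subseteq> U\<close>. The sets \<open>B\<^sub>n - cl (x\<^sub>n\<^sub>+\<^sub>1 U)\<close> have no cluster point \<open>y\<close>, for
  \<open>y \<in> cl B\<^sub>n\<^sub>+\<^sub>1\<close> for all \<open>n\<close> and hence \<open>y V \<subseteq> cl (x\<^sub>n\<^sub>+\<^sub>1 U)\<close>.\<close>

lemma inv_nbhd_in_closure:
  assumes fc: "feebly_compact T" and U: "openin T U" "\<one> \<in> U"
  shows "\<exists>W. openin T W \<and> \<one> \<in> W \<and> (\<forall>z\<in>W. inv z \<in> T closure_of U)"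
proof (rule ccontr)
  assume "\<not> ?thesis"
  then have bad: "\<exists>z\<in>W. inv z \<notin> T closure_of U" if "openin T W" "\<one> \<in> W" for W
    using that by blast
  obtain V where V: "openin T V" "\<one> \<in> V" "\<And>a b. a \<in> V \<Longrightarrow> b \<in> V \<Longrightarrow> a \<otimes> b \<in> U"
    using nbhd_one_square[OF U] by metis
  note Vc = openin_subset_carrier[OF V(1)]
  \<comment> \<open>Dependent choice of pairs: \<open>fst (p n)\<close> is the point and
    \<open>snd (p n)\<close> the open set around it.\<close>
  have "\<exists>p. \<forall>n. (openin T (snd (p n)) \<and> fst (p n) \<in> snd (p n)) \<and>
      (snd (p (Suc n)) \<subseteq> snd (p n) \<and> snd (p (Suc n)) \<subseteq> (\<otimes>) (fst (p (Suc n))) ` V \<and>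
       inv (fst (p (Suc n))) \<otimes> fst (p n) \<notin> T closure_of U)"
  proof (rule dependent_nat_choice)
    show "\<exists>p. openin T (snd p) \<and> fst p \<in> snd p"
      using U by (intro exI[of _ "(\<one>, U)"]) simp
  next
    fix p :: "'a \<times> 'a set" and n :: nat
    obtain x B where p: "p = (x, B)"
      by fastforce
    assume "openin T (snd p) \<and> fst p \<in> snd p"
    then have B: "openin T B" "x \<in> B" and x: "x \<in> carrier G"
      using p openin_subset_carrier by auto
    \<comment> \<open>This neighbourhood of \<open>\<one>\<close> contains a bad \<open>z\<close>,
      and moving from \<open>x\<close> to \<open>x \<otimes> z\<close> stays inside
      \<open>B\<close>.\<close>
    have "openin T {z \<in> topspace T. x \<otimes> z \<in> B}"
      using openin_continuous_map_preimage[OF continuous_map_mult_left[OF x] B(1)] .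
    then obtain z where z: "z \<in> carrier G" "x \<otimes> z \<in> B" "inv z \<notin> T closure_of U"
      using bad[of "{z \<in> topspace T. x \<otimes> z \<in> B}"] B x by (auto simp: topspace_eq_carrier)
    let ?x = "x \<otimes> z"
    have "inv ?x \<otimes> x = inv z"
      using x z by (simp add: inv_mult_group m_assoc)
    moreover have "?x \<in> (\<otimes>) ?x ` V"
      using V x z by (intro image_eqI[of _ _ \<one>]) auto
    ultimately show "\<exists>q. (openin T (snd q) \<and> fst q \<in> snd q) \<and>
        (snd q \<subseteq> snd p \<and> snd q \<subseteq> (\<otimes>) (fst q) ` V \<and> inv (fst q) \<otimes> fst p \<notin> T closure_of U)"
      using p z B x V(1) openin_left_translate[of V ?x]
      by (intro exI[of _ "(?x, B \<inter> (\<otimes>) ?x ` V)"]) auto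
  qed
  then obtain p where p: "\<And>n. openin T (snd (p n))" "\<And>n. fst (p n) \<in> snd (p n)"
    "\<And>n. snd (p (Suc n)) \<subseteq> snd (p n)" "\<And>n. snd (p (Suc n)) \<subseteq> (\<otimes>) (fst (p (Suc n))) ` V"
    "\<And>n. inv (fst (p (Suc n))) \<otimes> fst (p n) \<notin> T closure_of U"
    by blast
  define x where "x n = fst (p n)" for n
  define B where "B n = snd (p n)" for n
  note B = p[folded x_def B_def]
  have x: "x n \<in> carrier G" for n
    using B(1,2) openin_subset_carrier by blast
  have anti: "B m \<subseteq> B n" if "n \<le> m" for m n
    using that B(3) by (rule lift_Suc_antimono_le[rotated])
  define C where "C n = B n - T closure_of ((\<otimes>) (x (Suc n)) ` U)" for n
  have "openin T (C n)" for n
    unfolding C_def using B(1) by (intro openin_diff) auto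
  moreover have "x n \<in> C n" for n
  proof -
    \<comment> \<open>Left multiplication by the fixed element \<open>inv (x (Suc n))\<close>,
      treated as a singleton, would carry the closure back to that of \<open>U\<close>, against the
      choice of the points.\<close>
    have "inv (x (Suc n)) \<otimes> x n \<in> T closure_of U"
      if "x n \<in> T closure_of ((\<otimes>) (x (Suc n)) ` U)"
    proof (rule mult_in_closure_of)
      show "inv (x (Suc n)) \<in> T closure_of {inv (x (Suc n))}"
        using x by (intro in_closure_of_self) auto
      show "s \<otimes> t \<in> U" if "s \<in> {inv (x (Suc n))}" "t \<in> (\<otimes>) (x (Suc n)) ` U" for s t
        using that x openin_subset_carrier[OF U(1)] by (auto simp: m_assoc[symmetric])
    qed fact
    with B(2,5) show ?thesis
      by (auto simp: C_def)
  qed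
  ultimately obtain y where y: "cluster_point_in T C y"
    using feebly_compact_cluster_point[OF fc] by (metis empty_iff)
  then have yc: "y \<in> carrier G"
    by (simp add: cluster_point_in_def topspace_eq_carrier)
  have clos: "y \<in> T closure_of (B n)" for n
    unfolding in_closure_of
  proof (intro conjI allI impI)
    fix Q assume "y \<in> Q \<and> openin T Q"
    then obtain m where "m \<ge> n" "Q \<inter> C m \<noteq> {}"
      using cluster_point_in_openD[OF y] by metis
    then show "\<exists>z. z \<in> B n \<and> z \<in> Q"
      using anti[of n m] by (auto simp: C_def)
  qed (use yc topspace_eq_carrier in auto)
  have "y \<in> (\<otimes>) y ` V"
    using V yc by (intro image_eqI[of _ _ \<one>]) auto
  then obtain n where n: "(\<otimes>) y ` V \<inter> C n \<noteq> {}"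
    using cluster_point_in_openD[OF y openin_left_translate[OF V(1) yc]] by metis
  then obtain v where v: "v \<in> V" "y \<otimes> v \<in> C n"
    by auto
  have "y \<otimes> v \<in> T closure_of ((\<otimes>) (x (Suc n)) ` U)"
  proof (rule mult_in_closure_of[OF clos[of "Suc n"]])
    show "v \<in> T closure_of V"
      using v Vc by (intro in_closure_of_self) auto
    show "s \<otimes> t \<in> (\<otimes>) (x (Suc n)) ` U" if st: "s \<in> B (Suc n)" "t \<in> V" for s t
    proof -
      obtain w where "w \<in> V" "s = x (Suc n) \<otimes> w"
        using B(4)[of n] st by blast
      then show ?thesis
        using st Vc x V(3) by (intro image_eqI[of _ _ "w \<otimes> t"]) (auto simp: m_assoc subset_iff)
    qed
  qed
  with v show False
    by (simp add: C_def)
qed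

text \<open>With \<open>x\<^sub>n V\<^sub>n \<subseteq> U\<^sub>n\<close> and \<open>K\<^sub>k = cl V\<^sub>k\<close>, pass to a subsequence along which \<open>x\<^sub>i\<inverse> x\<^sub>j \<in> K\<^sub>k\<close>
  for \<open>i, j > k\<close>. Cluster points \<open>z\<close>, \<open>y\<close> of two further subsequences of \<open>x\<^sub>n V\<^sub>n\<^sub>+\<^sub>1\<close> then satisfy
  \<open>y\<inverse> z \<in> \<Inter>\<^sub>k K\<^sub>k\<close>, and right multiplication by such an element maps \<open>x\<^sub>n V\<^sub>n\<^sub>+\<^sub>1\<close> into
  \<open>cl (x\<^sub>n V\<^sub>n)\<close>. So \<open>z\<close> is a cluster point along every subsequence, that is, a limit.\<close>

lemma feebly_compact_imp_seq_feebly_compact: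
  assumes fc: "feebly_compact T"
  shows "seq_feebly_compact T"
  unfolding seq_feebly_compact_def
proof (intro allI impI)
  fix U :: "nat \<Rightarrow> 'a set" assume U: "\<forall>n. openin T (U n) \<and> U n \<noteq> {}"
  then have "\<exists>x. \<forall>n. x n \<in> U n"
    by (intro choice) blast
  then obtain x where xU: "\<And>n. x n \<in> U n"
    by blast
  then have x [simp]: "x n \<in> carrier G" for n
    using U openin_subset_carrier by blast
  have opn: "openin T {z \<in> carrier G. x n \<otimes> z \<in> U n}" for n
    using openin_continuous_map_preimage[OF continuous_map_mult_left, of "x n" "U n"] U x
    by (simp add: topspace_eq_carrier)
  have "\<exists>V. \<forall>n. (openin T (V n) \<and> \<one> \<in> V n \<and> (\<forall>v\<in>V n. x n \<otimes> v \<in> U n)) \<and>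
      ((\<forall>a\<in>V (Suc n). \<forall>b\<in>V (Suc n). a \<otimes> b \<in> V n) \<and> V (Suc n) \<subseteq> V n \<and>
       (\<forall>a\<in>V (Suc n). inv a \<in> T closure_of V n))" (is "\<exists>V. \<forall>n. ?\<Phi> V n")
  proof (rule dependent_nat_choice)
    show "\<exists>V. openin T V \<and> \<one> \<in> V \<and> (\<forall>v\<in>V. x 0 \<otimes> v \<in> U 0)"
      using opn[of 0] xU x by (intro exI[of _ "{z \<in> carrier G. x 0 \<otimes> z \<in> U 0}"]) auto
  next
    fix V n assume "openin T V \<and> \<one> \<in> V \<and> (\<forall>v\<in>V. x n \<otimes> v \<in> U n)"
    then have V: "openin T V" "\<one> \<in> V"
      by auto
    obtain P where P: "openin T P" "\<one> \<in> P" "P \<subseteq> V" "\<And>a b. a \<in> P \<Longrightarrow> b \<in> P \<Longrightarrow> a \<otimes> b \<in> V"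
      using nbhd_one_square[OF V] by metis
    obtain Q where Q: "openin T Q" "\<one> \<in> Q" "\<And>a. a \<in> Q \<Longrightarrow> inv a \<in> T closure_of V"
      using inv_nbhd_in_closure[OF fc V] by metis
    \<comment> \<open>\<open>P\<close> controls products, \<open>Q\<close> controls inverses, and
      the last set keeps the translate inside \<open>U (Suc n)\<close>.\<close>
    let ?W = "P \<inter> Q \<inter> {z \<in> carrier G. x (Suc n) \<otimes> z \<in> U (Suc n)}"
    have "openin T ?W"
      using P Q opn by blast
    then show "\<exists>W. (openin T W \<and> \<one> \<in> W \<and> (\<forall>v\<in>W. x (Suc n) \<otimes> v \<in> U (Suc n))) \<and>
        ((\<forall>a\<in>W. \<forall>b\<in>W. a \<otimes> b \<in> V) \<and> W \<subseteq> V \<and> (\<forall>a\<in>W. inv a \<in> T closure_of V))"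
      using P Q xU x by (intro exI[of _ ?W]) auto
  qed
  then obtain V where "\<forall>n. ?\<Phi> V n" ..
  then have V: "\<And>n. openin T (V n)" "\<And>n. \<one> \<in> V n"
      "\<And>n v. v \<in> V n \<Longrightarrow> x n \<otimes> v \<in> U n"
    and Vmult: "\<And>n a b. a \<in> V (Suc n) \<Longrightarrow> b \<in> V (Suc n) \<Longrightarrow> a \<otimes> b \<in> V n"
    and VSuc: "\<And>n. V (Suc n) \<subseteq> V n"
    and Vinv: "\<And>n a. a \<in> V (Suc n) \<Longrightarrow> inv a \<in> T closure_of V n"
    by simp_all
  have Vc [simp]: "v \<in> carrier G" if "v \<in> V n" for v n
    using V(1) that openin_subset_carrier by blast
  have Vanti: "V m \<subseteq> V n" if "n \<le> m" for m n
    using that VSuc by (rule lift_Suc_antimono_le[rotated])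
  define K where "K n = T closure_of V n" for n
  have KSuc: "a \<in> K n" if "a \<in> K (Suc n)" for a n
    using that closure_of_mono[OF VSuc] by (auto simp: K_def)
  have Kmult: "a \<otimes> b \<in> K n" if "a \<in> K (Suc n)" "b \<in> K (Suc n)" for a b n
    using mult_in_closure_of Vmult that unfolding K_def by metis
  have VK: "v \<in> K n" if "v \<in> V n" for v n
    using that by (auto simp: K_def intro: in_closure_of_self)
  have VinvK: "inv v \<in> K n" if "v \<in> V (Suc n)" for v n
    using Vinv that by (auto simp: K_def)
  have translate: "openin T ((\<otimes>) g ` V n)" "g \<in> (\<otimes>) g ` V n" if "g \<in> carrier G" for g n
    using that V openin_left_translate by (auto intro: image_eqI[of _ _ \<one>])

  \<comment> \<open>A Cauchy condition at level \<open>k\<close>; it concerns all pairs of indices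
    and is therefore inherited by subsequences.\<close>
  define P where "P k s \<longleftrightarrow> (\<forall>i j. inv (x (s i)) \<otimes> x (s j) \<in> K k)" for k and s :: "nat \<Rightarrow> nat"
  interpret subseqs P
  proof
    fix k and s :: "nat \<Rightarrow> nat"
    \<comment> \<open>Three levels are spent on
      \<open>w \<otimes> inv v \<otimes> (v' \<otimes> inv w')\<close>: one on inversion, one on
      each pair, one on the outer product.\<close>
    let ?W = "V (Suc (Suc (Suc k)))"
    obtain y where y: "cluster_point_in T (\<lambda>i. (\<otimes>) (x (s i)) ` ?W) y"
      using feebly_compact_cluster_point[OF fc, of "\<lambda>i. (\<otimes>) (x (s i)) ` ?W"] translate x
      by (metis empty_iff)
    then have yc [simp]: "y \<in> carrier G"
      by (simp add: cluster_point_in_def topspace_eq_carrier)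
    let ?S = "{i. (\<otimes>) y ` ?W \<inter> (\<otimes>) (x (s i)) ` ?W \<noteq> {}}"
    have "infinite ?S"
      using y translate[OF yc] by (simp add: cluster_point_in_def)
    from infinite_enumerate[OF this]
    obtain r :: "nat \<Rightarrow> nat" where r: "strict_mono r" "\<And>n. r n \<in> ?S"
      by blast
    have "P k (s \<circ> r)"
      unfolding P_def
    proof (intro allI)
      fix i j
      \<comment> \<open>All selected points lie close to the same \<open>y\<close>, which cancels in
        the quotient of any two of them.\<close>
      have "\<exists>v w. v \<in> ?W \<and> w \<in> ?W \<and> x (s (r n)) = y \<otimes> v \<otimes> inv w" for n
      proof -
        obtain v w where vw: "v \<in> ?W" "w \<in> ?W" "y \<otimes> v = x (s (r n)) \<otimes> w"
          using r(2)[of n] by auto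
        then have "x (s (r n)) = y \<otimes> v \<otimes> inv w"
          by (simp add: inv_solve_right)
        with vw show ?thesis
          by blast
      qed
      then obtain v w v' w' where vw: "v \<in> ?W" "w \<in> ?W" "v' \<in> ?W" "w' \<in> ?W"
        and eq: "x (s (r i)) = y \<otimes> v \<otimes> inv w" "x (s (r j)) = y \<otimes> v' \<otimes> inv w'"
        by metis
      have c: "v \<in> carrier G" "w \<in> carrier G" "v' \<in> carrier G" "w' \<in> carrier G"
        using vw by auto
      have "inv (x (s (r i))) \<otimes> x (s (r j)) = w \<otimes> inv v \<otimes> (v' \<otimes> inv w')"
        using c unfolding eq by (simp add: inv_mult_group m_assoc inv_mult_cancel)
      moreover have "w \<otimes> inv v \<otimes> (v' \<otimes> inv w') \<in> K k"
        using vw by (intro Kmult VinvK KSuc[OF VK])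
      ultimately show "inv (x ((s \<circ> r) i)) \<otimes> x ((s \<circ> r) j) \<in> K k"
        by simp
    qed
    with r show "\<exists>r. strict_mono r \<and> P k (s \<circ> r)"
      by blast
  qed
  define d where "d = diagseq"
  have d: "strict_mono d"
    using subseq_diagseq by (simp add: d_def)
  have Pd: "P k (d \<circ> (+) (Suc k))" for k
    unfolding d_def by (rule diagseq_holds) (simp add: P_def)
  have cauchy: "inv (x (d i)) \<otimes> x (d j) \<in> K k" if "i > k" "j > k" for i j k
    using Pd[of k, unfolded P_def, rule_format, of "i - Suc k" "j - Suc k"] that by simp

  \<comment> \<open>The index \<open>Suc n\<close> reserves one level for the later right
    multiplication by \<open>u\<close>.\<close>
  define C where "C n = (\<otimes>) (x n) ` V (Suc n)" for n
  have cluster: "\<exists>y. cluster_point_in T (C \<circ> (d \<circ> t)) y" for t :: "nat \<Rightarrow> nat"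
    using feebly_compact_cluster_point[OF fc, of "C \<circ> (d \<circ> t)"] translate(1)[OF x]
      translate(2)[OF x] unfolding C_def o_def by (metis empty_iff)
  have near: "\<exists>i v w. i > k \<and> v \<in> V k \<and> w \<in> V k \<and> y \<otimes> v = x (d i) \<otimes> w"
    if y: "cluster_point_in T (C \<circ> (d \<circ> t)) y" and t: "strict_mono t" for y k and t :: "nat \<Rightarrow> nat"
  proof -
    have "y \<in> carrier G"
      using y by (simp add: cluster_point_in_def topspace_eq_carrier)
    then obtain i where i: "i \<ge> Suc k" "(\<otimes>) y ` V k \<inter> (C \<circ> (d \<circ> t)) i \<noteq> {}"
      using cluster_point_in_openD[OF y translate] by metis
    then obtain v w where vw: "v \<in> V k" "w \<in> V (Suc (d (t i)))" "y \<otimes> v = x (d (t i)) \<otimes> w"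
      by (auto simp: C_def)
    \<comment> \<open>Strict monotonicity gives \<open>t i \<ge> i\<close> and
      \<open>d (t i) \<ge> t i\<close>, so the sets \<open>V (Suc (d (t i)))\<close> shrink into
      \<open>V k\<close>.\<close>
    have ti: "t i > k" "Suc (d (t i)) \<ge> k"
      using i(1) strict_mono_imp_increasing[OF t, of i] strict_mono_imp_increasing[OF d, of "t i"]
      by linarith+
    then have "w \<in> V k"
      using vw(2) Vanti by blast
    with ti vw show ?thesis
      by blast
  qed
  obtain z where z: "cluster_point_in T (C \<circ> (d \<circ> id)) z"
    using cluster by blast
  then have zc [simp]: "z \<in> carrier G"
    by (simp add: cluster_point_in_def topspace_eq_carrier)
  have "set_limit_in T (U \<circ> d) z"
    unfolding set_limit_in_def
  proof (intro conjI allI impI, goal_cases)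
    case (2 Q)
    show ?case
    proof (rule ccontr)
      assume "\<not> ?case"
      then have "infinite {n. Q \<inter> U (d n) = {}}"
        by (simp add: frequently_cofinite not_eventually cofinite_eq_sequentially[symmetric])
      from infinite_enumerate[OF this]
      obtain t :: "nat \<Rightarrow> nat" where t: "strict_mono t" "\<And>i. Q \<inter> U (d (t i)) = {}"
        by blast
      obtain y where y: "cluster_point_in T (C \<circ> (d \<circ> t)) y"
        using cluster by blast
      then have yc [simp]: "y \<in> carrier G"
        by (simp add: cluster_point_in_def topspace_eq_carrier)
      define u where "u = inv y \<otimes> z"
      have uc [simp]: "u \<in> carrier G"
        by (simp add: u_def)
      have u: "u \<in> K k" for k
      proof -
        \<comment> \<open>In the regrouped \<open>u\<close>, the bracket uses one level for
          \<open>w'\<close> and one for \<open>inv v'\<close>; the outer product uses the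
          third.\<close>
        let ?m = "Suc (Suc (Suc k))"
        obtain i v w where i: "i > ?m" "v \<in> V ?m" "w \<in> V ?m" "y \<otimes> v = x (d i) \<otimes> w"
          using near[OF y t(1)] by blast
        obtain j v' w' where j: "j > ?m" "v' \<in> V ?m" "w' \<in> V ?m" "z \<otimes> v' = x (d j) \<otimes> w'"
          using near[OF z strict_mono_id] by blast
        have c: "v \<in> carrier G" "w \<in> carrier G" "v' \<in> carrier G" "w' \<in> carrier G"
          using i j by auto
        have eq: "y = x (d i) \<otimes> w \<otimes> inv v" "z = x (d j) \<otimes> w' \<otimes> inv v'"
          using i(4) j(4) c by (simp_all add: inv_solve_right)
        have "u = v \<otimes> inv w \<otimes> (inv (x (d i)) \<otimes> x (d j) \<otimes> w' \<otimes> inv v')"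
          using c unfolding u_def eq by (simp add: inv_mult_group m_assoc)
        moreover have "v \<otimes> inv w \<in> K (Suc k)"
          using i by (intro Kmult VinvK KSuc[OF VK])
        moreover have "inv (x (d i)) \<otimes> x (d j) \<otimes> w' \<in> K (Suc (Suc k))"
          using i j by (intro Kmult[OF cauchy VK])
        then have "inv (x (d i)) \<otimes> x (d j) \<otimes> w' \<otimes> inv v' \<in> K (Suc k)"
          using j by (intro Kmult[OF _ VinvK])
        ultimately show ?thesis
          by (simp add: Kmult)
      qed
      have yu: "y \<otimes> u = z"
        by (simp add: u_def m_assoc[symmetric])
      \<comment> \<open>Since \<open>y \<otimes> u = z\<close> lies in \<open>Q\<close>, pulling
        \<open>Q\<close> back along right multiplication by \<open>u\<close> gives a neighbourhood
        of \<open>y\<close>, where the clustering along \<open>t\<close> applies.\<close>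
      let ?R = "{g \<in> topspace T. g \<otimes> u \<in> Q}"
      have "openin T ?R" "y \<in> ?R"
        using openin_continuous_map_preimage[OF continuous_map_mult_right[OF uc], of Q] 2 yu
        by (auto simp: topspace_eq_carrier)
      then obtain i where "?R \<inter> (C \<circ> (d \<circ> t)) i \<noteq> {}"
        using cluster_point_in_openD[OF y] by metis
      then obtain v where v: "v \<in> V (Suc (d (t i)))" "x (d (t i)) \<otimes> v \<otimes> u \<in> Q"
        by (auto simp: C_def)
      have "x (d (t i)) \<otimes> (v \<otimes> u) \<in> T closure_of U (d (t i))"
      proof (rule mult_in_closure_of)
        show "x (d (t i)) \<in> T closure_of {x (d (t i))}"
          by (intro in_closure_of_self) auto
        show "v \<otimes> u \<in> T closure_of V (d (t i))"
          using Kmult[OF VK u] v by (auto simp: K_def)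
      qed (use V(3) in auto)
      \<comment> \<open>An open set meeting a closure meets the set itself, which contradicts the
        choice of \<open>t\<close>.\<close>
      then have "Q \<inter> T closure_of U (d (t i)) \<noteq> {}"
        using v by (auto simp: m_assoc)
      then show False
        using 2 t(2) by (simp add: openin_Int_closure_of_eq_empty)
    qed
  qed (simp add: topspace_eq_carrier)
  then show "\<exists>z r. strict_mono r \<and> set_limit_in T (U \<circ> r) z"
    using d by blast
qed

end

theorem theorem4p1:
  fixes A :: "'i set"
    and G :: "'i \<Rightarrow> ('a, 'b) monoid_scheme"
    and T :: "'i \<Rightarrow> 'a topology"
  assumes "\<And>\<alpha>. \<alpha> \<in> A \<Longrightarrow> paratopological_group (G \<alpha>) (T \<alpha>)"
    and "\<And>\<alpha>. \<alpha> \<in> A \<Longrightarrow> feebly_compact (T \<alpha>)"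
  shows "feebly_compact (product_topology T A)"
  using assms paratopological_group.feebly_compact_imp_seq_feebly_compact
  by (blast intro: seq_feebly_compact_imp_feebly_compact seq_feebly_compact_product)

end
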